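(* For fixed positive integers $d$ and $\ell$ with $d \ge 2$ and $\ell \le d-1$, we have $$c'_{\ell}(H(d,n)) \le n^{d-\ell}\left(\frac{1}{3} + o(1)\right),$$ where the $o(1)$ term tends to $0$ as $n \to \infty$ (with $d$ and $\ell$ fixed).
   Context: Graphs are finite and simple. For positive integers $d,n$, the Hamming graph $H(d,n)$ is the $d$-fold Cartesian product of $K_n$: its vertices are the $d$-tuples with entries in $\{1,\dots,n\}$, two being adjacent iff they differ in exactly one coordinate. $\ell$-visibility Cops and Robbers on a graph $G$ ($\ell$ a nonnegative integer): a team of one or more cops and a single robber occupy vertices of $G$ (several cops may share a vertex). First the cops choose initial positions, then the robber, knowing them, chooses his. Thereafter the game proceeds in rounds, each a cop turn (each cop stays or moves to an adjacent vertex) followed by a robber turn (the robber stays or moves to an adjacent vertex). The robber always knows the cops' positions. The robber's position is unknown to the cops unless some cop is at distance at most $\ell$ from him; in that case the cops see the robber and all cops know his position. (A cop sees a vertex if she is within distance $\ell$ of it.) $c'_\ell(G)$ denotes the minimum number of cops having a strategy that guarantees that, within a finite number of rounds and regardless of how the robber plays (equivalently, even if he can anticipate the cops' moves), some cop sees the robber. Equivalently, it is the least $k$ for which $k$ cops can clean all vertices: after the initial placement the dirty vertices are those not within distance $\ell$ of a cop; in each cop turn, dirty vertices that are seen by cops in their new positions become clean; in each robber turn, every clean vertex that is adjacent to a dirty vertex and is not within distance $\ell$ of a cop becomes dirty. *)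

theory Defs
  imports Complex_Main "Graph_Theory.Graph_Theory"
begin

text \<open>
  Finite simple graphs are the locale \<open>pair_graph\<close>: an undirected edge is a pair of opposite arcs.
\<close>

definition hamming_graph :: "nat \<Rightarrow> nat \<Rightarrow> nat list pair_pre_digraph" where
  "hamming_graph d n =
     (let V = {x. length x = d \<and> set x \<subseteq> {1..n}}
      in \<lparr> pverts = V,
           parcs = {(x, y). x \<in> V \<and> y \<in> V \<and> card {i. i < d \<and> x ! i \<noteq> y ! i} = 1} \<rparr>)"

lemma finite_hamming_verts: "finite (pverts (hamming_graph d n))"
proof -
  have "{x. length x = d \<and> set x \<subseteq> {1..n}} = {x. set x \<subseteq> {1..n} \<and> length x = d}"
    by blast
  then show ?thesis
    using finite_lists_length_eq[of "{1..n}" d] by (simp add: hamming_graph_def Let_def)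
qed

lemma pair_graph_hamming: "pair_graph (hamming_graph d n)"
proof -
  let ?G = "hamming_graph d n"
  have sub: "parcs ?G \<subseteq> pverts ?G \<times> pverts ?G"
    unfolding hamming_graph_def Let_def pair_pre_digraph.simps by blast
  have loop: "fst e \<noteq> snd e" if "e \<in> parcs ?G" for e
  proof (cases e)
    case (Pair x y)
    with that have "card {i. i < d \<and> x ! i \<noteq> y ! i} = 1"
      unfolding hamming_graph_def Let_def pair_pre_digraph.simps by blast
    then have "x \<noteq> y" by (rule contrapos_pn) simp
    then show ?thesis using Pair by simp
  qed
  have arcs_swap: "(y, x) \<in> parcs ?G" if "(x, y) \<in> parcs ?G" for x y
  proof -
    have "{i. i < d \<and> y ! i \<noteq> x ! i} = {i. i < d \<and> x ! i \<noteq> y ! i}"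
      by auto
    with that show ?thesis
      unfolding hamming_graph_def Let_def pair_pre_digraph.simps by simp
  qed
  have "symmetric (with_proj ?G)"
    unfolding symmetric_def with_proj_simps by (rule symI) (rule arcs_swap)
  moreover have "finite (parcs ?G)"
    using sub finite_hamming_verts finite_subset by blast
  ultimately show ?thesis
    using sub loop finite_hamming_verts by unfold_locales (simp_all, force+)
qed

definition graph_dist :: "'a pair_pre_digraph \<Rightarrow> 'a \<Rightarrow> 'a \<Rightarrow> ereal" where
  "graph_dist G u v = wf_digraph.\<mu> (with_proj G) (\<lambda>_. 1) u v"

definition turn :: "'a pair_pre_digraph \<Rightarrow> 'a \<Rightarrow> 'a \<Rightarrow> bool" where
  "turn G u v \<longleftrightarrow> v = u \<or> (u, v) \<in> parcs G"

text \<open>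
  What a team of cops \<open>0, \<dots>, k - 1\<close>, standing on \<open>C 0, \<dots>, C (k - 1)\<close>, learns about a robber on
  \<open>v\<close> when its visibility is \<open>l\<close>.
\<close>

definition observation ::
    "nat \<Rightarrow> 'a pair_pre_digraph \<Rightarrow> nat \<Rightarrow> (nat \<Rightarrow> 'a) \<Rightarrow> 'a \<Rightarrow> 'a option" where
  "observation l G k C v =
     (if \<exists>i<k. graph_dist G (C i) v \<le> ereal (real l) then Some v else None)"

text \<open>
  A strategy maps the list of all observations made so far to the next positions of the cops, the
  empty list giving the initial placement. Its own earlier moves need not be an argument, since
  they are determined by the earlier observations.
\<close>

type_synonym 'a cop_strategy = "'a option list \<Rightarrow> nat \<Rightarrow> 'a"

text \<open>
  The robber's positions after his placement and after each of his turns form a sequence \<open>r\<close>. The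
  observations of the first \<open>t\<close> rounds are one after the placement and two in each round: after
  the cops' turn and after the robber's turn.
\<close>

primrec observations ::
    "nat \<Rightarrow> 'a pair_pre_digraph \<Rightarrow> nat \<Rightarrow> 'a cop_strategy \<Rightarrow> (nat \<Rightarrow> 'a) \<Rightarrow> nat \<Rightarrow> 'a option list" where
  "observations l G k S r 0 = [observation l G k (S []) (r 0)]"
| "observations l G k S r (Suc t) =
     (let h = observations l G k S r t
      in h @ [observation l G k (S h) (r t), observation l G k (S h) (r (Suc t))])"

primrec cop_positions ::
    "nat \<Rightarrow> 'a pair_pre_digraph \<Rightarrow> nat \<Rightarrow> 'a cop_strategy \<Rightarrow> (nat \<Rightarrow> 'a) \<Rightarrow> nat \<Rightarrow> nat \<Rightarrow> 'a" where
  "cop_positions l G k S r 0 = S []"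
| "cop_positions l G k S r (Suc t) = S (observations l G k S r t)"

text \<open>
  The robber is not given a strategy: quantifying over all his walks covers every way in which he
  may react to, or anticipate, the moves of the cops.
\<close>

definition robber_walk :: "'a pair_pre_digraph \<Rightarrow> (nat \<Rightarrow> 'a) \<Rightarrow> bool" where
  "robber_walk G r \<longleftrightarrow> r 0 \<in> pverts G \<and> (\<forall>t. turn G (r t) (r (Suc t)))"

definition legal_strategy :: "nat \<Rightarrow> 'a pair_pre_digraph \<Rightarrow> nat \<Rightarrow> 'a cop_strategy \<Rightarrow> bool" where
  "legal_strategy l G k S \<longleftrightarrow>
     (\<forall>i<k. S [] i \<in> pverts G) \<and>
     (\<forall>r. robber_walk G r \<longrightarrow>
        (\<forall>t. \<forall>i<k. turn G (cop_positions l G k S r t i) (cop_positions l G k S r (Suc t) i)))"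

definition can_see_robber :: "nat \<Rightarrow> 'a pair_pre_digraph \<Rightarrow> nat \<Rightarrow> bool" where
  "can_see_robber l G k \<longleftrightarrow>
     (\<exists>S. legal_strategy l G k S \<and>
        (\<exists>T. \<forall>r. robber_walk G r \<longrightarrow> (\<exists>v. Some v \<in> set (observations l G k S r T))))"

definition seeing_cop_number :: "nat \<Rightarrow> 'a pair_pre_digraph \<Rightarrow> nat" where
  "seeing_cop_number l G = (LEAST k. 1 \<le> k \<and> can_see_robber l G k)"

text \<open>The minimum is attained: a cop on every vertex sees the robber at once.\<close>

lemma seeing_cop_number_exists:
  assumes "pair_graph G" "pverts G \<noteq> {}"
  shows "\<exists>k\<ge>1. can_see_robber l G k"
proof -
  interpret pair_graph G by (rule assms)
  obtain f where f: "bij_betw f {0..<card (pverts G)} (pverts G)"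
    using ex_bij_betw_nat_finite[OF pair_finite_verts] by blast
  let ?k = "card (pverts G)" and ?S = "\<lambda>_. f"
  have pos: "cop_positions l G ?k ?S r t = f" for r t
    by (cases t) auto
  have "legal_strategy l G ?k ?S"
    using bij_betwE[OF f] by (simp add: legal_strategy_def pos turn_def del: cop_positions.simps)
  moreover have "\<exists>v. Some v \<in> set (observations l G ?k ?S r 0)" if "robber_walk G r" for r
  proof -
    have r0: "r 0 \<in> pverts G" using that by (simp add: robber_walk_def)
    then obtain i where i: "i < ?k" "f i = r 0"
      using bij_betw_imp_surj_on[OF f] by (metis atLeastLessThan_iff imageE)
    have "awalk (r 0) [] (r 0)" using r0 by (simp add: awalk_Nil_iff)
    then have "\<mu> (\<lambda>_. 1) (r 0) (r 0) \<le> ereal (awalk_cost (\<lambda>_. 1) [])"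
      by (rule min_cost_le_walk_cost)
    then have "graph_dist G (f i) (r 0) \<le> 0"
      by (simp add: graph_dist_def i zero_ereal_def)
    then have "graph_dist G (f i) (r 0) \<le> ereal (real l)"
      by (rule order_trans) simp
    then show ?thesis using i(1) by (auto simp: observation_def)
  qed
  ultimately have "can_see_robber l G ?k"
    unfolding can_see_robber_def by blast
  moreover have "?k \<ge> 1"
    using assms(2) pair_finite_verts by (simp add: Suc_le_eq card_gt_0_iff)
  ultimately show ?thesis by blast
qed

end

theory Submission
  imports Defs
begin

text \<open>
  A cop sees exactly the vertices that agree with hers in at least \<open>m = d - l\<close> coordinates, where
  \<open>1 \<le> m < d\<close>. Split the values of coordinate \<open>0\<close> into three blocks of size at most
  \<open>q = \<lceil>n / 3\<rceil>\<close>. With \<open>q * n ^ (m - 1)\<close> cops, one for each choice of an offset in a block and of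
  coordinates \<open>1, \<dots>, m - 1\<close>, every vertex whose coordinate \<open>0\<close> lies in a prescribed block is seen,
  and this block can be advanced cyclically in each round, since every cop has to change only
  coordinate \<open>0\<close>. Another \<open>n ^ (m - 1)\<close> cops see all vertices with a prescribed value in coordinate
  \<open>m\<close>; they sweep through the values \<open>1, \<dots>, n\<close>, one in each round.

  The point is that swept values of coordinate \<open>m\<close> are never recontaminated in a harmful way. A
  robber who is still unseen after the cops' turn is neither in the block just visited nor in the
  one before it, hence in the block that the cops visit next. To return to a swept value he must
  change coordinate \<open>m\<close>, so he cannot change coordinate \<open>0\<close> in the same turn, and the next turn
  of the cops reveals him. Hence an unseen robber is always either at a value not yet swept or
  in the block visited next (\<open>unseen_robber_invariant\<close>), and once all values are swept he is
  caught. The number of cops is \<open>(q + 1) * n ^ (m - 1) \<le> n ^ m * (1 / 3 + 2 / n)\<close>.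

  The cops use no information about the robber, so their strategy is just a timetable of positions
  (\<open>can_see_robber_by_schedule\<close>).
\<close>

section \<open>Schedules of cops that ignore their observations\<close>

definition sees :: "nat \<Rightarrow> 'a pair_pre_digraph \<Rightarrow> 'i set \<Rightarrow> ('i \<Rightarrow> 'a) \<Rightarrow> 'a \<Rightarrow> bool" where
  "sees l G I C v \<longleftrightarrow> (\<exists>i\<in>I. graph_dist G (C i) v \<le> ereal (real l))"

lemma length_observations: "length (observations l G k S r t) = 2 * t + 1"
  by (induction t) (simp_all add: Let_def)

lemma observations_mono:
  assumes "t \<le> T"
  shows "set (observations l G k S r t) \<subseteq> set (observations l G k S r T)"
  using assms by (induction T rule: dec_induct) (auto simp: Let_def)

text \<open>
  The number of observations made so far tells the time, so a strategy in the sense of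
  \<open>can_see_robber\<close> can follow any timetable. Cops may be named by the elements of a finite set.
\<close>

lemma can_see_robber_by_schedule:
  fixes P :: "nat \<Rightarrow> 'i \<Rightarrow> 'a"
  assumes fin: "finite I"
    and verts: "\<And>i. i \<in> I \<Longrightarrow> P 0 i \<in> pverts G"
    and moves: "\<And>t i. i \<in> I \<Longrightarrow> turn G (P t i) (P (Suc t) i)"
    and seen: "\<And>r. robber_walk G r \<Longrightarrow>
      \<exists>t<T. sees l G I (P t) (r t) \<or> sees l G I (P (Suc t)) (r t)"
  shows "can_see_robber l G (card I)"
proof -
  obtain f where f: "bij_betw f {0..<card I} I"
    using ex_bij_betw_nat_finite[OF fin] by blast
  have fI: "f i \<in> I" if "i < card I" for i
    using f that by (auto dest: bij_betwE)
  \<comment> \<open>The placement follows \<open>0\<close> observations, and the cops' turn \<open>t + 1\<close> follows \<open>2 * t + 1\<close>.\<close>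
  define S :: "'a cop_strategy" where "S h i = P ((length h + 1) div 2) (f i)" for h i
  have S0: "S [] = (\<lambda>i. P 0 (f i))"
    by (simp add: S_def fun_eq_iff)
  have St: "S (observations l G (card I) S r t) = (\<lambda>i. P (Suc t) (f i))" for r t
    by (simp add: S_def fun_eq_iff length_observations)
  have pos: "cop_positions l G (card I) S r t = (\<lambda>i. P t (f i))" for r t
    by (cases t) (simp_all add: S0 St)
  have "legal_strategy l G (card I) S"
    by (simp add: legal_strategy_def pos S0 fI verts moves del: cop_positions.simps)
  moreover have "\<exists>v. Some v \<in> set (observations l G (card I) S r T)" if r: "robber_walk G r" for r
  proof -
    have obs: "observation l G (card I) (\<lambda>i. P s (f i)) v = Some v"
      if "sees l G I (P s) v" for s v
    proof -
      from that obtain j where "j \<in> I" "graph_dist G (P s j) v \<le> ereal (real l)"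
        by (auto simp: sees_def)
      moreover from \<open>j \<in> I\<close> obtain i where "i < card I" "f i = j"
        using bij_betw_imp_surj_on[OF f] by (metis atLeastLessThan_iff imageE)
      ultimately show ?thesis by (auto simp: observation_def)
    qed
    have after_robber: "observation l G (card I) (\<lambda>i. P t (f i)) (r t)
        \<in> set (observations l G (card I) S r t)" for t
      by (cases t) (simp_all add: S0 St Let_def)
    have after_cops: "observation l G (card I) (\<lambda>i. P (Suc t) (f i)) (r t)
        \<in> set (observations l G (card I) S r (Suc t))" for t
      by (simp add: St Let_def)
    obtain t where t: "t < T" "sees l G I (P t) (r t) \<or> sees l G I (P (Suc t)) (r t)"
      using seen[OF r] by blast
    have "Some (r t) \<in> set (observations l G (card I) S r t) \<or>
          Some (r t) \<in> set (observations l G (card I) S r (Suc t))"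
      using t(2) after_robber[of t] after_cops[of t] obs by metis
    then show ?thesis
      using observations_mono[of t T l G "card I" S r]
        observations_mono[of "Suc t" T l G "card I" S r] t(1) by auto
  qed
  ultimately show ?thesis
    unfolding can_see_robber_def by blast
qed

section \<open>Visibility in Hamming graphs\<close>

lemma hamming_vertex_iff:
  "v \<in> pverts (hamming_graph d n) \<longleftrightarrow> length v = d \<and> set v \<subseteq> {1..n}"
  by (simp add: hamming_graph_def Let_def)

lemma hamming_arc_iff:
  "(u, v) \<in> parcs (hamming_graph d n) \<longleftrightarrow>
     u \<in> pverts (hamming_graph d n) \<and> v \<in> pverts (hamming_graph d n) \<and>
     card {i. i < d \<and> u ! i \<noteq> v ! i} = 1"
  by (simp add: hamming_graph_def Let_def)

lemma turn_list_update:
  assumes "u \<in> pverts (hamming_graph d n)" "i < d" "a \<in> {1..n}"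
  shows "turn (hamming_graph d n) u (u[i := a])"
proof (cases "a = u ! i")
  case True
  then show ?thesis by (simp add: turn_def)
next
  case False
  have "{j. j < d \<and> u ! j \<noteq> u[i := a] ! j} = {i}"
    using assms False by (auto simp: hamming_vertex_iff nth_list_update)
  moreover have "set (u[i := a]) \<subseteq> {1..n}"
    using assms set_update_subset_insert[of u i a] by (auto simp: hamming_vertex_iff)
  ultimately show ?thesis
    using assms by (simp add: turn_def hamming_arc_iff hamming_vertex_iff)
qed

text \<open>Correcting the differing coordinates one at a time gives a walk of the required length.\<close>

lemma graph_dist_hamming_le:
  assumes "u \<in> pverts (hamming_graph d n)" "v \<in> pverts (hamming_graph d n)"
  shows "graph_dist (hamming_graph d n) u v \<le> ereal (real (card {i. i < d \<and> u ! i \<noteq> v ! i}))"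
proof -
  let ?G = "hamming_graph d n"
  interpret pair_graph ?G by (rule pair_graph_hamming)
  have "\<exists>p. awalk u p v \<and> length p = card {i. i < d \<and> u ! i \<noteq> v ! i}"
    using assms
  proof (induction "card {i. i < d \<and> u ! i \<noteq> v ! i}" arbitrary: u)
    case 0
    then have "{i. i < d \<and> u ! i \<noteq> v ! i} = {}" by simp
    with 0 have "u = v" by (auto simp: hamming_vertex_iff intro: nth_equalityI)
    with 0 show ?case
      by (intro exI[of _ "[]"]) (simp add: awalk_Nil_iff)
  next
    case (Suc k)
    let ?D = "{i. i < d \<and> u ! i \<noteq> v ! i}"
    have "?D \<noteq> {}" using Suc.hyps(2) by (metis card.empty nat.distinct(1))
    then obtain i where i: "i < d" "u ! i \<noteq> v ! i" by blast
    let ?w = "u[i := v ! i]"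
    have vi: "v ! i \<in> {1..n}"
      using Suc.prems(2) i(1) by (metis hamming_vertex_iff nth_mem subsetD)
    have len: "length u = d" using Suc.prems(1) by (simp add: hamming_vertex_iff)
    have "?w \<noteq> u" using i len by (metis nth_list_update_eq)
    then have arc: "(u, ?w) \<in> parcs ?G"
      using turn_list_update[OF Suc.prems(1) i(1) vi] by (simp add: turn_def)
    have "{j. j < d \<and> ?w ! j \<noteq> v ! j} = ?D - {i}"
      using len i(1) by (auto simp: nth_list_update split: if_splits)
    then have dist: "card {j. j < d \<and> ?w ! j \<noteq> v ! j} = k"
      using Suc.hyps(2) i by simp
    have "?w \<in> pverts ?G" using arc by (simp add: hamming_arc_iff)
    from Suc.hyps(1)[OF dist[symmetric] this Suc.prems(2)]
    obtain p where "awalk ?w p v" "length p = k" using dist by auto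
    with arc Suc.hyps(2) show ?case
      by (intro exI[of _ "(u, ?w) # p"]) (simp add: awalk_Cons_iff)
  qed
  then obtain p where p: "awalk u p v" "length p = card {i. i < d \<and> u ! i \<noteq> v ! i}"
    by blast
  have "\<mu> (\<lambda>_. 1) u v \<le> ereal (awalk_cost (\<lambda>_. 1) p)"
    using p(1) by (rule min_cost_le_walk_cost)
  moreover have "awalk_cost (\<lambda>_. 1) p = real (length p)"
    by (simp add: awalk_cost_def sum_list_triv)
  ultimately show ?thesis
    using p(2) by (simp add: graph_dist_def)
qed

lemma graph_dist_le_if_agree:
  assumes "u \<in> pverts (hamming_graph d n)" "v \<in> pverts (hamming_graph d n)"
    and agree: "\<And>i. i \<in> A \<Longrightarrow> i < d \<and> u ! i = v ! i" and A: "card A \<ge> d - l"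
  shows "graph_dist (hamming_graph d n) u v \<le> ereal (real l)"
proof -
  have sub: "A \<subseteq> {..<d}" using agree by auto
  have "card {i. i < d \<and> u ! i \<noteq> v ! i} \<le> card ({..<d} - A)"
    by (rule card_mono) (use agree in auto)
  also have "\<dots> = d - card A"
    using sub by (subst card_Diff_subset) (auto intro: finite_subset)
  also have "\<dots> \<le> l" using A by simp
  finally have "ereal (real (card {i. i < d \<and> u ! i \<noteq> v ! i})) \<le> ereal (real l)" by simp
  then show ?thesis
    using graph_dist_hamming_le[OF assms(1,2)] by (rule order_trans[rotated])
qed

section \<open>Cycling through three blocks while sweeping\<close>

text \<open>
  Cop \<open>(j, s)\<close> keeps the coordinates \<open>s\<close> between coordinates \<open>0\<close> and \<open>m = length s + 1\<close>. For
  \<open>j < q\<close> she has the offset \<open>j\<close> in the block of time \<open>t\<close>; for \<open>j = q\<close> she is a sweeper. Positions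
  are cut off at \<open>n\<close> because the last block may be incomplete.
\<close>

definition cop_schedule :: "nat \<Rightarrow> nat \<Rightarrow> nat \<Rightarrow> nat \<Rightarrow> nat \<times> nat list \<Rightarrow> nat list" where
  "cop_schedule n q e t = (\<lambda>(j, s).
     (if j < q then min n (q * (t mod 3) + j + 1) else 1)
     # s @ (if j < q then 1 else min n (t + 1)) # replicate e 1)"

definition cop_names :: "nat \<Rightarrow> nat \<Rightarrow> nat \<Rightarrow> (nat \<times> nat list) set" where
  "cop_names n q k = {..q} \<times> {s. set s \<subseteq> {1..n} \<and> length s = k}"

lemma finite_cop_names: "finite (cop_names n q k)"
  unfolding cop_names_def by (intro finite_cartesian_product finite_lists_length_eq) auto

lemma card_cop_names: "card (cop_names n q k) = (q + 1) * n ^ k"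
  unfolding cop_names_def by (simp add: card_cartesian_product card_lists_length_eq)

lemma cop_schedule_vertex:
  assumes "n \<ge> 1" "c \<in> cop_names n q k"
  shows "cop_schedule n q e t c \<in> pverts (hamming_graph (k + e + 2) n)"
  using assms by (cases c) (auto simp: cop_schedule_def cop_names_def hamming_vertex_iff)

lemma cop_schedule_turn:
  assumes "n \<ge> 1" "c \<in> cop_names n q k"
  shows "turn (hamming_graph (k + e + 2) n) (cop_schedule n q e t c) (cop_schedule n q e (Suc t) c)"
proof -
  obtain j s where c: "c = (j, s)" by (cases c)
  have s: "length s = k" using assms(2) by (simp add: c cop_names_def)
  have "\<exists>i a. i < k + e + 2 \<and> a \<in> {1..n} \<and>
      cop_schedule n q e (Suc t) c = (cop_schedule n q e t c)[i := a]"
  proof (cases "j < q")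
    case True
    with assms(1) show ?thesis
      by (intro exI[of _ 0] exI[of _ "min n (q * (Suc t mod 3) + j + 1)"])
        (simp add: c cop_schedule_def)
  next
    case False
    with assms(1) s show ?thesis
      by (intro exI[of _ "Suc k"] exI[of _ "min n (Suc t + 1)"])
        (simp add: c cop_schedule_def list_update_append)
  qed
  then show ?thesis
    using turn_list_update[OF cop_schedule_vertex[OF assms]] by fastforce
qed

context
  fixes n q k e d l :: nat
  assumes n: "n \<ge> 1" and q: "n \<le> 3 * q" and d: "d = k + e + 2" and l: "l = e + 1"
begin

abbreviation seen :: "nat \<Rightarrow> nat list \<Rightarrow> bool" where
  "seen t v \<equiv> sees l (hamming_graph d n) (cop_names n q k) (cop_schedule n q e t) v"

abbreviation block :: "nat list \<Rightarrow> nat" where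
  "block v \<equiv> (v ! 0 - 1) div q"

lemma vertex_nth:
  assumes "v \<in> pverts (hamming_graph d n)" "i < d"
  shows "1 \<le> v ! i" "v ! i \<le> n"
proof -
  have "v ! i \<in> {1..n}" using assms nth_mem[of i v] by (auto simp only: hamming_vertex_iff)
  then show "1 \<le> v ! i" "v ! i \<le> n" by simp_all
qed

lemma middle_coordinates:
  assumes v: "v \<in> pverts (hamming_graph d n)" and "j \<le> q"
  shows "(j, take k (drop 1 v)) \<in> cop_names n q k"
proof -
  have "set (take k (drop 1 v)) \<subseteq> set v"
    by (meson order_trans set_drop_subset set_take_subset)
  then show ?thesis
    using assms by (auto simp: cop_names_def hamming_vertex_iff d)
qed

text \<open>
  The cop with the offset and the middle coordinates of \<open>v\<close> agrees with \<open>v\<close> in coordinates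
  \<open>0, \<dots>, k\<close>; these are \<open>d - l\<close> many. The cut-off at \<open>n\<close> does not move her away from \<open>v ! 0\<close>. For
  swept values, the sweeper with the middle coordinates of \<open>v\<close> agrees with it in \<open>1, \<dots>, k + 1\<close>.
\<close>

lemma seen_if_block:
  assumes v: "v \<in> pverts (hamming_graph d n)" and b: "block v = t mod 3"
  shows "seen t v"
proof -
  have q0: "q > 0" using n q by simp
  let ?j = "(v ! 0 - 1) mod q" and ?s = "take k (drop 1 v)"
  let ?c = "(?j, ?s)"
  have len: "length v = d" using v by (simp add: hamming_vertex_iff)
  have c: "?c \<in> cop_names n q k"
    using middle_coordinates[OF v] q0 by (simp add: less_imp_le)
  have v0: "1 \<le> v ! 0" "v ! 0 \<le> n" using vertex_nth[OF v, of 0] d by auto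
  have "q * (t mod 3) + ?j + 1 = v ! 0"
    using v0 b[symmetric] by simp
  then have first: "min n (q * (t mod 3) + ?j + 1) = v ! 0" using v0 by simp
  have "graph_dist (hamming_graph d n) (cop_schedule n q e t ?c) v \<le> ereal (real l)"
  proof (rule graph_dist_le_if_agree[where A = "{..k}"])
    show "cop_schedule n q e t ?c \<in> pverts (hamming_graph d n)"
      using cop_schedule_vertex[OF n c] by (simp add: d)
    show "i < d \<and> cop_schedule n q e t ?c ! i = v ! i" if "i \<in> {..k}" for i
      using that q0 first len
      by (cases i) (auto simp: cop_schedule_def nth_append d)
  qed (use v d l in auto)
  then show ?thesis using c by (auto simp: sees_def)
qed

lemma seen_if_swept_now:
  assumes v: "v \<in> pverts (hamming_graph d n)" and b: "v ! (k + 1) = t + 1"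
  shows "seen t v"
proof -
  let ?s = "take k (drop 1 v)"
  let ?c = "(q, ?s)"
  have len: "length v = d" using v by (simp add: hamming_vertex_iff)
  have c: "?c \<in> cop_names n q k"
    using middle_coordinates[OF v] by simp
  have vn: "min n (t + 1) = v ! (k + 1)" using vertex_nth[OF v, of "k + 1"] b d by simp
  have "graph_dist (hamming_graph d n) (cop_schedule n q e t ?c) v \<le> ereal (real l)"
  proof (rule graph_dist_le_if_agree[where A = "{1..k + 1}"])
    show "cop_schedule n q e t ?c \<in> pverts (hamming_graph d n)"
      using cop_schedule_vertex[OF n c] by (simp add: d)
    show "i < d \<and> cop_schedule n q e t ?c ! i = v ! i" if i: "i \<in> {1..k + 1}" for i
    proof (cases "i = k + 1")
      case True
      then show ?thesis using vn len by (simp add: cop_schedule_def nth_append d)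
    next
      case False
      then show ?thesis using i len
        by (cases i) (auto simp: cop_schedule_def nth_append d)
    qed
  qed (use v d l in auto)
  then show ?thesis using c by (auto simp: sees_def)
qed

lemma robber_walk_vertex:
  assumes "robber_walk (hamming_graph d n) r"
  shows "r t \<in> pverts (hamming_graph d n)"
proof (induction t)
  case (Suc t)
  have "turn (hamming_graph d n) (r t) (r (Suc t))" using assms by (simp add: robber_walk_def)
  with Suc show ?case by (auto simp: turn_def hamming_arc_iff)
qed (use assms in \<open>simp add: robber_walk_def\<close>)

lemma turn_changes_one:
  assumes "turn (hamming_graph d n) u v" "i < d" "j < d" "i \<noteq> j" "u ! i \<noteq> v ! i"
  shows "u ! j = v ! j"
proof (rule ccontr)
  assume "u ! j \<noteq> v ! j"
  with assms have "{i, j} \<subseteq> {i. i < d \<and> u ! i \<noteq> v ! i}" by auto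
  then have "card {i, j} \<le> card {i. i < d \<and> u ! i \<noteq> v ! i}"
    by (intro card_mono) auto
  with assms show False by (auto simp: turn_def hamming_arc_iff)
qed

text \<open>
  Coordinate \<open>k + 1\<close> is the swept one. The two blocks excluded in the inductive step leave only the
  block of time \<open>t + 2\<close>, and a robber who crosses into the swept values stays in it.
\<close>

lemma unseen_robber_invariant:
  assumes r: "robber_walk (hamming_graph d n) r"
    and unseen: "\<And>s. s < t \<Longrightarrow> \<not> seen s (r s) \<and> \<not> seen (Suc s) (r s)"
    and now: "\<not> seen t (r t)"
  shows "t + 1 < r t ! (k + 1) \<or> block (r t) = Suc t mod 3"
  using unseen now
proof (induction t)
  case 0
  have v: "r 0 \<in> pverts (hamming_graph d n)" by (rule robber_walk_vertex[OF r])
  have "r 0 ! (k + 1) \<noteq> 1" using 0 seen_if_swept_now[OF v, of 0] by auto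
  then show ?case using vertex_nth(1)[OF v, of "k + 1"] d by auto
next
  case (Suc t)
  have v: "r t \<in> pverts (hamming_graph d n)" by (rule robber_walk_vertex[OF r])
  have un: "\<not> seen t (r t)" "\<not> seen (Suc t) (r t)" using Suc.prems(1)[of t] by auto
  have "t + 1 < r t ! (k + 1) \<or> block (r t) = Suc t mod 3"
    using Suc.IH Suc.prems(1) un(1) by simp
  moreover have b: "block (r t) \<noteq> t mod 3" "block (r t) \<noteq> Suc t mod 3"
    using un seen_if_block[OF v] by blast+
  moreover have "r t ! (k + 1) \<noteq> Suc t + 1" using un(2) seen_if_swept_now[OF v] by blast
  ultimately have large: "Suc t + 1 < r t ! (k + 1)" by simp
  have "block (r t) < 3"
    using vertex_nth[OF v, of 0] n q d by (intro less_mult_imp_div_less) simp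
  moreover have "x = Suc (Suc t) mod 3" if "x \<noteq> t mod 3" "x \<noteq> Suc t mod 3" "x < 3" for x :: nat
  proof -
    have "t mod 3 = 0 \<or> t mod 3 = 1 \<or> t mod 3 = 2" by linarith
    then show ?thesis using that by (elim disjE) (simp_all add: mod_Suc)
  qed
  ultimately have next_block: "block (r t) = Suc (Suc t) mod 3" using b by blast
  show ?case
  proof (cases "r t ! (k + 1) = r (Suc t) ! (k + 1)")
    case True
    with large show ?thesis by simp
  next
    case False
    have "turn (hamming_graph d n) (r t) (r (Suc t))" using r by (simp add: robber_walk_def)
    from turn_changes_one[OF this _ _ _ False, of 0] next_block d
    show ?thesis by simp
  qed
qed

lemma can_see_robber_hamming: "can_see_robber l (hamming_graph d n) ((q + 1) * n ^ k)"
proof -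
  have "can_see_robber l (hamming_graph d n) (card (cop_names n q k))"
  proof (rule can_see_robber_by_schedule[where P = "cop_schedule n q e" and T = n])
    show "\<exists>t<n. seen t (r t) \<or> seen (Suc t) (r t)"
      if r: "robber_walk (hamming_graph d n) r" for r
    proof (rule ccontr)
      assume "\<not> ?thesis"
      then have un: "\<not> seen t (r t) \<and> \<not> seen (Suc t) (r t)" if "t < n" for t
        using that by blast
      \<comment> \<open>At time \<open>n - 1\<close> all values \<open>1, \<dots>, n\<close> have been swept.\<close>
      let ?t = "n - 1"
      have v: "r ?t \<in> pverts (hamming_graph d n)" by (rule robber_walk_vertex[OF r])
      have "?t + 1 < r ?t ! (k + 1) \<or> block (r ?t) = Suc ?t mod 3"
        by (rule unseen_robber_invariant[OF r]) (use un n in auto)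
      moreover have "r ?t ! (k + 1) \<le> n" using vertex_nth(2)[OF v] d by simp
      ultimately have "seen (Suc ?t) (r ?t)"
        using seen_if_block[OF v] n by auto
      then show False using un[of ?t] n by simp
    qed
  qed (use cop_schedule_vertex[OF n] cop_schedule_turn[OF n] finite_cop_names d in auto)
  then show ?thesis by (simp add: card_cop_names)
qed

end

section \<open>The asymptotic bound\<close>

theorem corollary4p3:
  fixes d l :: nat
  assumes "d \<ge> 2" and "l \<ge> 1" and "l \<le> d - 1"
  shows "\<exists>\<epsilon> :: nat \<Rightarrow> real. \<epsilon> \<longlonglongrightarrow> 0 \<and>
           (\<forall>n\<ge>1. real (seeing_cop_number l (hamming_graph d n)) \<le> real n ^ (d - l) * (1 / 3 + \<epsilon> n))"
proof (intro exI[of _ "\<lambda>n. 2 / real n"] conjI allI impI)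
  show "(\<lambda>n. 2 / real n) \<longlonglongrightarrow> 0" by (rule lim_const_over_n)
next
  fix n :: nat
  assume n: "n \<ge> 1"
  define k where "k = d - l - 1"
  have m: "d - l = Suc k" using assms by (simp add: k_def)
  define q where "q = (n + 2) div 3"
  have q: "n \<le> 3 * q" "3 * q \<le> n + 2" by (simp_all add: q_def)
  have "can_see_robber l (hamming_graph d n) ((q + 1) * n ^ k)"
    by (rule can_see_robber_hamming[where e = "l - 1"]) (use n q assms in \<open>simp_all add: k_def\<close>)
  moreover have "0 < (q + 1) * n ^ k" using n by simp
  then have "1 \<le> (q + 1) * n ^ k" by linarith
  ultimately have "seeing_cop_number l (hamming_graph d n) \<le> (q + 1) * n ^ k"
    unfolding seeing_cop_number_def by (intro Least_le conjI)
  then have "real (seeing_cop_number l (hamming_graph d n)) \<le> real ((q + 1) * n ^ k)"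
    by (simp only: of_nat_le_iff)
  also have "\<dots> = (real q + 1) * real n ^ k" by (simp add: algebra_simps)
  also have "\<dots> \<le> (real n / 3 + 2) * real n ^ k"
  proof (rule mult_right_mono)
    show "real q + 1 \<le> real n / 3 + 2" using q(2) by linarith
  qed simp
  also have "\<dots> = real n ^ (d - l) * (1 / 3 + 2 / real n)"
    using n by (simp add: m field_simps)
  finally show "real (seeing_cop_number l (hamming_graph d n))
      \<le> real n ^ (d - l) * (1 / 3 + 2 / real n)" .
qed

end
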